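(* Let $F(\mathbf t)$, $\mathbf t=(t_1,t_3,t_5,\dots)$, be a $\tau$-function of the dispersionless BKP hierarchy, let $z_1,z_2,z_3$ satisfy $|z_i|>1$ and $z_i\neq\pm z_j$ for $i\ne j$, and put $\mathcal D_i=\mathcal D(z_i)$. Let $\Phi(\mathbf t)$ be a function such that $p(z_i)=\mathcal D_i\Phi$ for $i=1,2,3$. Then $$\mathcal D_1\ln\frac{\mathcal D_2\Phi+\mathcal D_3\Phi}{\mathcal D_2\Phi-\mathcal D_3\Phi}=\mathcal D_2\ln\frac{\mathcal D_1\Phi+\mathcal D_3\Phi}{\mathcal D_1\Phi-\mathcal D_3\Phi}.$$ Moreover, writing $\Phi_i=\mathcal D_i\Phi$, $\Phi_{ij}=\mathcal D_i\mathcal D_j\Phi$, this equation can be written in the symmetric form $$\Phi_{23}\Phi_1(\Phi_2^2-\Phi_3^2)+\Phi_{31}\Phi_2(\Phi_3^2-\Phi_1^2)+\Phi_{12}\Phi_3(\Phi_1^2-\Phi_2^2)=0,$$ and, equivalently, as $$\det\begin{pmatrix}\Phi_1&\Phi_2&\Phi_3\\ \Phi_2\Phi_3&\Phi_1\Phi_3&\Phi_1\Phi_2\\ \Phi_{23}&\Phi_{13}&\Phi_{12}\end{pmatrix}=0 .$$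
   Context: The B-type quasiclassical vertex operator is $\mathcal D(z)=2\sum_{n=0}^\infty\frac{z^{-(2n+1)}}{2n+1}\frac{\partial}{\partial t_{2n+1}}$, $|z|>1$. A $\tau$-function of the dispersionless BKP hierarchy is a smooth function $F(\mathbf t)$ such that, with $p(z)=z-\partial_{t_1}\mathcal D(z)F$, $$\frac{p(z_1)-p(z_2)}{p(z_1)+p(z_2)}=\frac{z_1-z_2}{z_1+z_2}\,e^{\mathcal D(z_1)\mathcal D(z_2)F}$$ for all $|z_1|,|z_2|>1$ with $z_1\ne -z_2$ (in particular $p(z_1)+p(z_2)\ne0$). All series obtained by applying vertex operators are assumed to converge; vertex operators commute. An expression $\mathcal D_i\ln g$ means $(\mathcal D_i g)/g$. *)

theory Defs
  imports "HOL-Analysis.Analysis"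
begin

text \<open>The times \<open>(t\<^sub>1, t\<^sub>3, t\<^sub>5, \<dots>)\<close> are real; the \<open>n\<close>-th entry of a sequence
  \<open>t :: times\<close> is \<open>t\<^sub>2\<^sub>n\<^sub>+\<^sub>1\<close>, so \<open>t 0\<close> is \<open>t\<^sub>1\<close>.\<close>

type_synonym times = "nat \<Rightarrow> real"

definition time_slice :: "times \<Rightarrow> nat set \<Rightarrow> times set" where
  "time_slice t N = {t'. \<forall>n. n \<notin> N \<longrightarrow> t' n = t n}"

text \<open>Functions of the times need not be defined for all sequences. Their domain is only required
  to be open in finitely many coordinates at a time (for example, the finitely supported
  sequences). On a slice with finite \<open>N\<close> the product topology is that of \<open>\<real>\<^sup>N\<close>.\<close>

definition time_domain :: "times set \<Rightarrow> bool" where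
  "time_domain U \<longleftrightarrow>
     (\<forall>t\<in>U. \<forall>N. finite N \<longrightarrow> openin (top_of_set (time_slice t N)) (U \<inter> time_slice t N))"

definition partially_differentiable :: "times set \<Rightarrow> (times \<Rightarrow> complex) \<Rightarrow> bool" where
  "partially_differentiable U g \<longleftrightarrow>
     (\<forall>t\<in>U. \<forall>n. (\<lambda>s. g (t(n := s))) differentiable at (t n))"

definition partial :: "nat \<Rightarrow> (times \<Rightarrow> complex) \<Rightarrow> times \<Rightarrow> complex" where
  "partial n g t = vector_derivative (\<lambda>s. g (t(n := s))) (at (t n))"

text \<open>Smooth means \<open>C\<^sup>\<infinity>\<close> jointly in any finite number of the times.\<close>

definition smooth_in_times :: "times set \<Rightarrow> (times \<Rightarrow> complex) \<Rightarrow> bool" where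
  "smooth_in_times U g \<longleftrightarrow>
     (\<forall>ns. partially_differentiable U (foldr partial ns g) \<and>
        (\<forall>t\<in>U. \<forall>N. finite N \<longrightarrow> continuous_on (U \<inter> time_slice t N) (foldr partial ns g)))"

definition vertex_term :: "complex \<Rightarrow> (times \<Rightarrow> complex) \<Rightarrow> times \<Rightarrow> nat \<Rightarrow> complex" where
  "vertex_term z g t n = z powi (- (2 * int n + 1)) / of_nat (2 * n + 1) * partial n g t"

definition vertex :: "complex \<Rightarrow> (times \<Rightarrow> complex) \<Rightarrow> times \<Rightarrow> complex" where
  "vertex z g t = 2 * (\<Sum>n. vertex_term z g t n)"

definition vertex_ln :: "complex \<Rightarrow> (times \<Rightarrow> complex) \<Rightarrow> times \<Rightarrow> complex" where
  "vertex_ln z g t = vertex z g t / g t"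

text \<open>The standing assumption on convergence and commutation, for a function \<open>g\<close> to which vertex
  operators with parameters in \<open>Z\<close> are applied: in each function obtained from \<open>g\<close> by finitely many
  of them, all terms of the next series exist, the series converge, and the operators commute.\<close>

definition vertex_regular :: "times set \<Rightarrow> complex set \<Rightarrow> (times \<Rightarrow> complex) \<Rightarrow> bool" where
  "vertex_regular U Z g \<longleftrightarrow>
     (\<forall>zs. set zs \<subseteq> Z \<longrightarrow>
        (let h = foldr vertex zs g in
           partially_differentiable U h \<and>
           (\<forall>z\<in>Z. \<forall>t\<in>U. summable (vertex_term z h t)) \<and>
           (\<forall>z\<in>Z. \<forall>w\<in>Z. \<forall>t\<in>U. vertex z (vertex w h) t = vertex w (vertex z h) t)))"

definition momentum :: "(times \<Rightarrow> complex) \<Rightarrow> complex \<Rightarrow> times \<Rightarrow> complex" where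
  "momentum F z t = z - partial 0 (vertex z F) t"

definition dBKP_tau :: "times set \<Rightarrow> (times \<Rightarrow> complex) \<Rightarrow> bool" where
  "dBKP_tau U F \<longleftrightarrow>
     smooth_in_times U F \<and> vertex_regular U {z. norm z > 1} F \<and>
     (\<forall>t\<in>U. \<forall>z w. norm z > 1 \<longrightarrow> norm w > 1 \<longrightarrow> z \<noteq> - w \<longrightarrow>
        momentum F z t + momentum F w t \<noteq> 0 \<and>
        (momentum F z t - momentum F w t) / (momentum F z t + momentum F w t) =
          (z - w) / (z + w) * exp (vertex z (vertex w F) t))"

definition log_equation ::
  "complex \<Rightarrow> complex \<Rightarrow> complex \<Rightarrow> (times \<Rightarrow> complex) \<Rightarrow> times \<Rightarrow> bool" where
  "log_equation z1 z2 z3 \<Phi> t \<longleftrightarrow>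
     vertex_ln z1 (\<lambda>t. (vertex z2 \<Phi> t + vertex z3 \<Phi> t) / (vertex z2 \<Phi> t - vertex z3 \<Phi> t)) t =
     vertex_ln z2 (\<lambda>t. (vertex z1 \<Phi> t + vertex z3 \<Phi> t) / (vertex z1 \<Phi> t - vertex z3 \<Phi> t)) t"

definition symmetric_equation ::
  "complex \<Rightarrow> complex \<Rightarrow> complex \<Rightarrow> (times \<Rightarrow> complex) \<Rightarrow> times \<Rightarrow> bool" where
  "symmetric_equation z1 z2 z3 \<Phi> t \<longleftrightarrow>
     (let \<Phi>1 = vertex z1 \<Phi> t; \<Phi>2 = vertex z2 \<Phi> t; \<Phi>3 = vertex z3 \<Phi> t;
          \<Phi>12 = vertex z1 (vertex z2 \<Phi>) t;
          \<Phi>23 = vertex z2 (vertex z3 \<Phi>) t;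
          \<Phi>31 = vertex z3 (vertex z1 \<Phi>) t
      in \<Phi>23 * \<Phi>1 * (\<Phi>2\<^sup>2 - \<Phi>3\<^sup>2) + \<Phi>31 * \<Phi>2 * (\<Phi>3\<^sup>2 - \<Phi>1\<^sup>2) + \<Phi>12 * \<Phi>3 * (\<Phi>1\<^sup>2 - \<Phi>2\<^sup>2) = 0)"

definition det_equation ::
  "complex \<Rightarrow> complex \<Rightarrow> complex \<Rightarrow> (times \<Rightarrow> complex) \<Rightarrow> times \<Rightarrow> bool" where
  "det_equation z1 z2 z3 \<Phi> t \<longleftrightarrow>
     (let \<Phi>1 = vertex z1 \<Phi> t; \<Phi>2 = vertex z2 \<Phi> t; \<Phi>3 = vertex z3 \<Phi> t;
          \<Phi>12 = vertex z1 (vertex z2 \<Phi>) t;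
          \<Phi>13 = vertex z1 (vertex z3 \<Phi>) t;
          \<Phi>23 = vertex z2 (vertex z3 \<Phi>) t
      in det (vector [vector [\<Phi>1, \<Phi>2, \<Phi>3],
                      vector [\<Phi>2 * \<Phi>3, \<Phi>1 * \<Phi>3, \<Phi>1 * \<Phi>2],
                      vector [\<Phi>23, \<Phi>13, \<Phi>12]] :: complex ^ 3 ^ 3) = 0)"

end

(* The tau-function equation says that (p2 + p3) / (p2 - p3) is a constant multiple of
   exp (- D2 D3 F), so its logarithmic derivative along D1 is - D1 D2 D3 F, which is symmetric in
   the indices by commutation of the vertex operators.  The other forms follow from the quotient rule
   D1 ln ((u + v) / (u - v)) = 2 (u D1 v - v D1 u) / (u^2 - v^2) by clearing denominators. *)
theory Submission
  imports Defs
begin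

lemma partial_has_vector_derivative:
  assumes "partially_differentiable U g" and "t \<in> U"
  shows "((\<lambda>s. g (t(n := s))) has_vector_derivative partial n g t) (at (t n))"
  using assms unfolding partially_differentiable_def partial_def
  by (simp add: vector_derivative_works)

text \<open>The line \<open>s \<mapsto> t(n := s)\<close> is continuous coordinatewise and stays in
  the slice through \<open>t\<close>, so the relatively open part of the domain pulls back to a
  neighbourhood of \<open>t n\<close>. This permits partial differentiation of identities known only
  on \<open>U\<close>.\<close>

lemma eventually_in_time_domain:
  assumes U: "time_domain U" and t: "t \<in> U"
  shows "\<forall>\<^sub>F s in nhds (t n). t(n := s) \<in> U"
proof -
  let ?S = "time_slice t {n}"
  have "openin (top_of_set ?S) (U \<inter> ?S)"
    using U t unfolding time_domain_def by blast
  then obtain V where V: "open V" "U \<inter> ?S = ?S \<inter> V"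
    by (auto simp: openin_open)
  have slice: "t(n := s) \<in> ?S" for s
    by (simp add: time_slice_def)
  have "continuous_on UNIV (\<lambda>s. t(n := s))"
  proof (rule continuous_on_coordinatewise_then_product)
    fix i
    show "continuous_on UNIV (\<lambda>s. (t(n := s)) i)"
      by (cases "i = n") auto
  qed
  then have "open ((\<lambda>s. t(n := s)) -` V)"
    using V(1) by (rule open_vimage[rotated])
  moreover have "t n \<in> (\<lambda>s. t(n := s)) -` V"
    using V(2) slice[of "t n"] t by auto
  ultimately have "\<forall>\<^sub>F s in nhds (t n). s \<in> (\<lambda>s. t(n := s)) -` V"
    by (rule eventually_nhds_in_open)
  then show ?thesis
    by (rule eventually_mono) (use V(2) slice in auto)
qed

text \<open>A vertex operator is a series of partial derivatives at a single point, so a linear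
  relation among these with coefficients independent of \<open>n\<close> passes to the sums. The
  coefficients \<open>a\<close> and \<open>b\<close> may be values of functions at \<open>t\<close>,
  as the quotient and chain rules produce them.\<close>

lemma vertex_eqI:
  assumes "summable (vertex_term z u t)" and "summable (vertex_term z v t)"
    and eq: "\<And>n. partial n g t = a * partial n u t + b * partial n v t"
  shows "vertex z g t = a * vertex z u t + b * vertex z v t"
proof -
  have "vertex_term z g t n = a * vertex_term z u t n + b * vertex_term z v t n" for n
    by (simp add: vertex_term_def eq algebra_simps add_divide_distrib)
  then have "vertex_term z g t = (\<lambda>n. a * vertex_term z u t n + b * vertex_term z v t n)"
    by blast
  then have "suminf (vertex_term z g t) =
      a * suminf (vertex_term z u t) + b * suminf (vertex_term z v t)"
    using assms(1,2) by (simp add: suminf_add[symmetric] suminf_mult summable_mult)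
  then show ?thesis
    by (simp add: vertex_def algebra_simps)
qed

lemma vertex_ln_quotient:
  assumes "partially_differentiable U u" and "partially_differentiable U v" and "t \<in> U"
    and "summable (vertex_term z u t)" and "summable (vertex_term z v t)"
    and ne: "u t \<noteq> v t" "u t \<noteq> - v t"
  shows "vertex_ln z (\<lambda>t. (u t + v t) / (u t - v t)) t =
    2 * (u t * vertex z v t - v t * vertex z u t) / ((u t)\<^sup>2 - (v t)\<^sup>2)"
proof -
  let ?g = "\<lambda>t. (u t + v t) / (u t - v t)"
  have plus: "u t + v t \<noteq> 0" and minus: "u t - v t \<noteq> 0"
    using ne by (auto simp: add_eq_0_iff2)
  have "partial n ?g t =
      - 2 * v t / (u t - v t)\<^sup>2 * partial n u t + 2 * u t / (u t - v t)\<^sup>2 * partial n v t" for n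
  proof -
    let ?u' = "partial n u t" and ?v' = "partial n v t"
    have u: "((\<lambda>s. u (t(n := s))) has_derivative (\<lambda>h. h *\<^sub>R ?u')) (at (t n))"
      and v: "((\<lambda>s. v (t(n := s))) has_derivative (\<lambda>h. h *\<^sub>R ?v')) (at (t n))"
      using partial_has_vector_derivative[OF assms(1,3)] partial_has_vector_derivative[OF assms(2,3)]
      by (simp_all add: has_vector_derivative_def)
    have "((\<lambda>s. ?g (t(n := s))) has_derivative
        (\<lambda>h. ((h *\<^sub>R ?u' + h *\<^sub>R ?v') * (u t - v t) - (u t + v t) * (h *\<^sub>R ?u' - h *\<^sub>R ?v'))
            / ((u t - v t) * (u t - v t)))) (at (t n))"
      using has_derivative_divide'[OF has_derivative_add[OF u v] has_derivative_diff[OF u v]] minus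
      by simp
    then have "((\<lambda>s. ?g (t(n := s))) has_vector_derivative
        (- 2 * v t / (u t - v t)\<^sup>2 * ?u' + 2 * u t / (u t - v t)\<^sup>2 * ?v')) (at (t n))"
      unfolding has_vector_derivative_def
      by (rule has_derivative_eq_rhs)
        (simp add: fun_eq_iff scaleR_conv_of_real power2_eq_square add_divide_distrib
          diff_divide_distrib algebra_simps)
    then show ?thesis
      by (simp add: partial_def vector_derivative_at)
  qed
  then have "vertex z ?g t = - 2 * v t / (u t - v t)\<^sup>2 * vertex z u t +
      2 * u t / (u t - v t)\<^sup>2 * vertex z v t"
    by (rule vertex_eqI[OF assms(4,5)])
  also have "\<dots> = 2 * (u t * vertex z v t - v t * vertex z u t) / (u t - v t)\<^sup>2"
    by (simp add: diff_divide_distrib algebra_simps)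
  finally have "vertex z ?g t = \<dots>" .
  \<comment> \<open>Dividing by \<open>(u t + v t) / (u t - v t)\<close> trades one factor
    \<open>u t - v t\<close> of the squared denominator for \<open>u t + v t\<close>.\<close>
  moreover have "(u t)\<^sup>2 - (v t)\<^sup>2 = (u t + v t) * (u t - v t)"
    by (simp add: algebra_simps power2_eq_square)
  ultimately show ?thesis
    using plus minus by (simp add: vertex_ln_def power2_eq_square)
qed

text \<open>The constant \<open>c\<close> cancels from the logarithmic derivative of
  \<open>c * exp (- h)\<close>. This turns the exponential form of the tau-function equation into a
  linear statement about \<open>h\<close>.\<close>

lemma vertex_ln_exp:
  assumes U: "time_domain U" and t: "t \<in> U"
    and h: "partially_differentiable U h" "summable (vertex_term z h t)"
    and g: "\<And>t'. t' \<in> U \<Longrightarrow> g t' = c * exp (- h t')" and "c \<noteq> 0"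
  shows "vertex_ln z g t = - vertex z h t"
proof -
  \<comment> \<open>The zero summand only brings the chain rule into the two-term shape of
    \<open>vertex_eqI\<close>.\<close>
  have "partial n g t = - g t * partial n h t + 0 * partial n h t" for n
  proof -
    have "(exp \<circ> (\<lambda>s. - h (t(n := s))) has_vector_derivative - partial n h t * exp (- h t))
        (at (t n))"
      using partial_has_vector_derivative[OF h(1) t, of n]
      by (intro field_vector_diff_chain_at has_vector_derivative_minus)
        (auto intro!: derivative_eq_intros)
    then have "((\<lambda>s. c * exp (- h (t(n := s)))) has_vector_derivative - g t * partial n h t)
        (at (t n))"
      using has_vector_derivative_mult_right[of _ _ "at (t n)" c] g[OF t]
      by (fastforce simp: o_def mult_ac)
    \<comment> \<open>Outside \<open>U\<close> the function \<open>g\<close> is unconstrained, but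
      its derivative at \<open>t n\<close> depends only on \<open>s\<close> near \<open>t n\<close>,
      where the formula applies.\<close>
    moreover have "\<forall>\<^sub>F s in nhds (t n). c * exp (- h (t(n := s))) = g (t(n := s))"
      using eventually_in_time_domain[OF U t, of n] by (rule eventually_mono) (simp add: g)
    ultimately have "((\<lambda>s. g (t(n := s))) has_vector_derivative - g t * partial n h t) (at (t n))"
      using g[OF t]
      by (subst (asm) has_vector_derivative_cong_ev) (auto elim: eventually_mono)
    then show ?thesis
      by (simp add: partial_def vector_derivative_at)
  qed
  then have "vertex z g t = - g t * vertex z h t + 0 * vertex z h t"
    by (rule vertex_eqI[OF h(2,2)])
  then show ?thesis
    using g[OF t] \<open>c \<noteq> 0\<close> by (simp add: vertex_ln_def)
qed

lemma vertex_regular_foldr: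
  assumes "vertex_regular U Z g" and "set zs \<subseteq> Z"
  shows "partially_differentiable U (foldr vertex zs g)"
    and "z \<in> Z \<Longrightarrow> t \<in> U \<Longrightarrow> summable (vertex_term z (foldr vertex zs g) t)"
    and "z \<in> Z \<Longrightarrow> w \<in> Z \<Longrightarrow> t \<in> U \<Longrightarrow>
      vertex z (vertex w (foldr vertex zs g)) t = vertex w (vertex z (foldr vertex zs g)) t"
  using assms unfolding vertex_regular_def Let_def by blast+

text \<open>Expanding the determinant along its third row gives the cofactors
  \<open>\<Phi>1 * (\<Phi>2\<^sup>2 - \<Phi>3\<^sup>2)\<close> and its cyclic analogues, so it is
  the symmetric expression once \<open>\<Phi>31\<close> and \<open>\<Phi>13\<close> are identified
  by commutation.\<close>

lemma symmetric_iff_det_equation: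
  assumes "vertex_regular U {z1, z2, z3} \<Psi>" and "t \<in> U"
  shows "symmetric_equation z1 z2 z3 \<Psi> t \<longleftrightarrow> det_equation z1 z2 z3 \<Psi> t"
proof -
  have "vertex z3 (vertex z1 \<Psi>) t = vertex z1 (vertex z3 \<Psi>) t"
    using vertex_regular_foldr(3)[OF assms(1), of "[]" z3 z1 t] assms(2) by simp
  then show ?thesis
    unfolding symmetric_equation_def det_equation_def Let_def det_3
    by (simp add: algebra_simps power2_eq_square)
qed

lemma log_iff_symmetric_equation:
  assumes reg: "vertex_regular U {z1, z2, z3} \<Psi>" and t: "t \<in> U"
    and ne: "vertex z2 \<Psi> t \<noteq> vertex z3 \<Psi> t" "vertex z2 \<Psi> t \<noteq> - vertex z3 \<Psi> t"
      "vertex z1 \<Psi> t \<noteq> vertex z3 \<Psi> t" "vertex z1 \<Psi> t \<noteq> - vertex z3 \<Psi> t"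
  shows "log_equation z1 z2 z3 \<Psi> t \<longleftrightarrow> symmetric_equation z1 z2 z3 \<Psi> t"
proof -
  have diff: "partially_differentiable U (vertex z \<Psi>)" if "z \<in> {z1, z2, z3}" for z
    using vertex_regular_foldr(1)[OF reg, of "[z]"] that by simp
  have summ: "summable (vertex_term w (vertex z \<Psi>) t)"
    if "z \<in> {z1, z2, z3}" "w \<in> {z1, z2, z3}" for z w
    using vertex_regular_foldr(2)[OF reg, of "[z]" w t] that t by simp
  have comm: "vertex z (vertex w \<Psi>) t = vertex w (vertex z \<Psi>) t"
    if "z \<in> {z1, z2, z3}" "w \<in> {z1, z2, z3}" for z w
    using vertex_regular_foldr(3)[OF reg, of "[]" z w t] that t by simp
  define p1 p2 p3 where "p1 = vertex z1 \<Psi> t" and "p2 = vertex z2 \<Psi> t" and "p3 = vertex z3 \<Psi> t"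
  define q12 q13 q23 where "q12 = vertex z1 (vertex z2 \<Psi>) t"
    and "q13 = vertex z1 (vertex z3 \<Psi>) t" and "q23 = vertex z2 (vertex z3 \<Psi>) t"
  \<comment> \<open>The four inequalities say precisely that both denominators from the quotient
    rule are nonzero, so clearing them is reversible.\<close>
  have nz: "p2\<^sup>2 - p3\<^sup>2 \<noteq> 0" "p1\<^sup>2 - p3\<^sup>2 \<noteq> 0"
    using ne by (auto simp: p1_def p2_def p3_def power2_eq_iff)
  have "log_equation z1 z2 z3 \<Psi> t \<longleftrightarrow>
      2 * (p2 * q13 - p3 * q12) / (p2\<^sup>2 - p3\<^sup>2) = 2 * (p1 * q23 - p3 * q12) / (p1\<^sup>2 - p3\<^sup>2)"
    using vertex_ln_quotient[OF diff diff t summ summ ne(1,2), of z1]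
      vertex_ln_quotient[OF diff diff t summ summ ne(3,4), of z2] comm[of z2 z1]
    by (simp add: log_equation_def p1_def p2_def p3_def q12_def q13_def q23_def)
  also have "\<dots> \<longleftrightarrow> (p2 * q13 - p3 * q12) * (p1\<^sup>2 - p3\<^sup>2) = (p1 * q23 - p3 * q12) * (p2\<^sup>2 - p3\<^sup>2)"
    using nz by (simp add: frac_eq_eq mult.assoc del: right_diff_distrib_numeral)
  \<comment> \<open>The products \<open>p3 ^ 3 * q12\<close> cancel, and left minus right is the
    negative of the symmetric expression.\<close>
  also have "\<dots> \<longleftrightarrow>
      q23 * p1 * (p2\<^sup>2 - p3\<^sup>2) + q13 * p2 * (p3\<^sup>2 - p1\<^sup>2) + q12 * p3 * (p1\<^sup>2 - p2\<^sup>2) = 0"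
    by algebra
  also have "\<dots> \<longleftrightarrow> symmetric_equation z1 z2 z3 \<Psi> t"
    using comm[of z3 z1]
    by (simp add: symmetric_equation_def Let_def p1_def p2_def p3_def q12_def q13_def q23_def)
  finally show ?thesis .
qed

lemma dBKP_momentum:
  assumes "dBKP_tau U F" and "t \<in> U" and "norm z > 1" and "norm w > 1" and "z \<noteq> w" and "z \<noteq> - w"
  shows "momentum F z t \<noteq> momentum F w t" and "momentum F z t \<noteq> - momentum F w t"
    and "(momentum F z t + momentum F w t) / (momentum F z t - momentum F w t) =
      (z + w) / (z - w) * exp (- vertex z (vertex w F) t)"
proof -
  have sum: "momentum F z t + momentum F w t \<noteq> 0"
    and eq: "(momentum F z t - momentum F w t) / (momentum F z t + momentum F w t) =
      (z - w) / (z + w) * exp (vertex z (vertex w F) t)"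
    using assms unfolding dBKP_tau_def by blast+
  from sum show "momentum F z t \<noteq> - momentum F w t"
    by auto
  \<comment> \<open>Division by zero yields 0, so without this the factor
    \<open>(z - w) / (z + w)\<close> could vanish; now the right-hand side of \<open>eq\<close> is
    nonzero.\<close>
  have "z + w \<noteq> 0"
    using assms(6) by (simp add: eq_neg_iff_add_eq_0)
  with eq assms(5) show "momentum F z t \<noteq> momentum F w t"
    by auto
  show "(momentum F z t + momentum F w t) / (momentum F z t - momentum F w t) =
      (z + w) / (z - w) * exp (- vertex z (vertex w F) t)"
    using arg_cong[OF eq, of inverse] by (simp add: exp_minus divide_inverse mult_ac)
qed

text \<open>Both sides reduce to minus the triple derivative of \<open>F\<close> along
  \<open>z1\<close>, \<open>z2\<close>, \<open>z3\<close>, and commutation identifies the two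
  orders.\<close>

lemma dBKP_log_equation:
  assumes U: "time_domain U" and tau: "dBKP_tau U F" and t: "t \<in> U"
    and norm: "norm z1 > 1" "norm z2 > 1" "norm z3 > 1"
    and ne: "z1 \<noteq> z3" "z1 \<noteq> - z3" "z2 \<noteq> z3" "z2 \<noteq> - z3"
    and mom: "\<forall>z\<in>{z1, z2, z3}. \<forall>t\<in>U. momentum F z t = vertex z \<Phi> t"
  shows "log_equation z1 z2 z3 \<Phi> t"
proof -
  have reg: "vertex_regular U {z. norm z > 1} F"
    using tau by (simp add: dBKP_tau_def)
  have "vertex_ln w (\<lambda>t. (vertex z \<Phi> t + vertex z3 \<Phi> t) / (vertex z \<Phi> t - vertex z3 \<Phi> t)) t =
      - vertex w (vertex z (vertex z3 F)) t"
    \<comment> \<open>Used twice: with \<open>w\<close> and \<open>z\<close> equal to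
      \<open>z1\<close> and \<open>z2\<close>, and with these exchanged.\<close>
    if "z \<in> {z1, z2}" "norm w > 1" for z w
  proof (rule vertex_ln_exp[OF U t])
    have z: "norm z > 1" "z \<noteq> z3" "z \<noteq> - z3"
      using that norm ne by auto
    show "partially_differentiable U (vertex z (vertex z3 F))"
      using vertex_regular_foldr(1)[OF reg, of "[z, z3]"] z norm by simp
    show "summable (vertex_term w (vertex z (vertex z3 F)) t)"
      using vertex_regular_foldr(2)[OF reg, of "[z, z3]" w t] z norm that t by simp
    show "(vertex z \<Phi> t' + vertex z3 \<Phi> t') / (vertex z \<Phi> t' - vertex z3 \<Phi> t') =
        (z + z3) / (z - z3) * exp (- vertex z (vertex z3 F) t')" if "t' \<in> U" for t'
      using dBKP_momentum(3)[OF tau that z(1) norm(3) z(2,3)] mom that \<open>z \<in> {z1, z2}\<close> by auto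
    show "(z + z3) / (z - z3) \<noteq> 0"
      using z by (simp add: eq_neg_iff_add_eq_0)
  qed
  moreover have "vertex z1 (vertex z2 (vertex z3 F)) t = vertex z2 (vertex z1 (vertex z3 F)) t"
    using vertex_regular_foldr(3)[OF reg, of "[z3]" z1 z2 t] norm t by simp
  ultimately show ?thesis
    using norm by (simp add: log_equation_def)
qed

text \<open>For \<open>\<Phi>\<close> all three equations hold, which would make their equivalence
  trivial. The equivalence is therefore stated for every regular \<open>\<Psi>\<close>, wherever the
  fractions inside the logarithms have nonzero numerator and denominator.\<close>

theorem mainTheorem4:
  fixes U :: "times set" and F \<Phi> :: "times \<Rightarrow> complex" and z1 z2 z3 :: complex
  assumes "time_domain U"
    and "dBKP_tau U F"
    and "norm z1 > 1" and "norm z2 > 1" and "norm z3 > 1"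
    and "z1 \<noteq> z2" and "z1 \<noteq> - z2"
    and "z1 \<noteq> z3" and "z1 \<noteq> - z3"
    and "z2 \<noteq> z3" and "z2 \<noteq> - z3"
    and "vertex_regular U {z1, z2, z3} \<Phi>"
    and "\<forall>z\<in>{z1, z2, z3}. \<forall>t\<in>U. momentum F z t = vertex z \<Phi> t"
  shows "(\<forall>t\<in>U. log_equation z1 z2 z3 \<Phi> t \<and> symmetric_equation z1 z2 z3 \<Phi> t \<and>
            det_equation z1 z2 z3 \<Phi> t) \<and>
         (\<forall>\<Psi>. vertex_regular U {z1, z2, z3} \<Psi> \<longrightarrow>
            (\<forall>t\<in>U. vertex z2 \<Psi> t \<noteq> vertex z3 \<Psi> t \<and> vertex z2 \<Psi> t \<noteq> - vertex z3 \<Psi> t \<and>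
                   vertex z1 \<Psi> t \<noteq> vertex z3 \<Psi> t \<and> vertex z1 \<Psi> t \<noteq> - vertex z3 \<Psi> t \<longrightarrow>
              (log_equation z1 z2 z3 \<Psi> t \<longleftrightarrow> symmetric_equation z1 z2 z3 \<Psi> t) \<and>
              (symmetric_equation z1 z2 z3 \<Psi> t \<longleftrightarrow> det_equation z1 z2 z3 \<Psi> t)))"
proof (intro conjI ballI allI impI; (elim conjE)?)
  fix t
  assume t: "t \<in> U"
  have p: "vertex z \<Phi> t = momentum F z t" if "z \<in> {z1, z2, z3}" for z
    using assms(13) t that by auto
  show log: "log_equation z1 z2 z3 \<Phi> t"
    using dBKP_log_equation[OF assms(1,2) t assms(3-5,8-11,13)] .
  \<comment> \<open>The inequalities required for clearing denominators come from the tau-function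
    equation through \<open>dBKP_momentum\<close>.\<close>
  show symm: "symmetric_equation z1 z2 z3 \<Phi> t"
    using log log_iff_symmetric_equation[OF assms(12) t]
      dBKP_momentum(1,2)[OF assms(2) t assms(4,5,10,11)]
      dBKP_momentum(1,2)[OF assms(2) t assms(3,5,8,9)]
    by (simp add: p)
  show "det_equation z1 z2 z3 \<Phi> t"
    using symm symmetric_iff_det_equation[OF assms(12) t] by simp
qed (use log_iff_symmetric_equation symmetric_iff_det_equation in blast)+

end
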